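(* Let $U$ be a finite set and $v:2^U\to\mathbb{R}_+$ a monotone subadditive function with $v(\emptyset)=0$. Let $B\in\mathbb{R}_+$, $\kappa\in(0,1)$, and $S\subseteq U$. Fix an optimal solution $(p,\mu)\in\mathbb{R}^S_+\times\mathbb{R}_+$ to the linear program $$\min\ \kappa\, p(S)+\mu\quad\text{s.t.}\quad p(T)+\mu\ge v(T)\ \ \forall T\subseteq S,\quad p,\mu\ge 0,$$ and let $d=d^{S,\kappa}\in\mathbb{R}^U_+$ be the vector given by $d_e=p_e\cdot\frac{B}{p(S)}$ for $e\in S$ and $d_e=0$ for $e\in U\setminus S$. Then $d$ satisfies the following: (i) $d(S)=B$; (ii) for all $c\in\mathbb{R}^S_+$ with $c(S)\le\kappa B$, we have $$v(\{e\in S: c_e\le d_e\})\ \ge\ v(S)-\mathrm{OPT}_{\mathrm{LP}}(\kappa,S).$$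
   Context: For a set $S$ and vector $x$, $x(S)=\sum_{e\in S}x_e$. Subadditive: $v(S)+v(T)\ge v(S\cup T)$ for all $S,T\subseteq U$; monotone: $v(S)\le v(T)$ whenever $S\subseteq T\subseteq U$. $\mathrm{OPT}_{\mathrm{LP}}(\kappa,S)$ denotes the optimal value of the linear program $$\max\ \sum_{T\subseteq S}v(T)x_T\quad\text{s.t.}\quad \sum_{T\subseteq S:\,e\in T}x_T\le\kappa\ \ \forall e\in S,\quad \sum_{T\subseteq S}x_T\le 1,\quad x\ge 0,$$ whose LP dual is the minimization program in the claim.
   Formalization: Part (i) is stated only when p(S) ≠ 0, since otherwise d_e = p_e·B/p(S) is undefined (e.g. v = 1 on nonempty sets, |S| ≥ 2, κ = 1/2, p = 0, μ = 1); part (ii) is proved in all cases, with d = 0 when p(S) = 0. *)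

theory Defs
  imports Complex_Main
begin

definition monotone_on_subsets :: "'a set \<Rightarrow> ('a set \<Rightarrow> real) \<Rightarrow> bool" where
  "monotone_on_subsets U v \<longleftrightarrow> (\<forall>S T. S \<subseteq> T \<longrightarrow> T \<subseteq> U \<longrightarrow> v S \<le> v T)"

definition subadditive_on_subsets :: "'a set \<Rightarrow> ('a set \<Rightarrow> real) \<Rightarrow> bool" where
  "subadditive_on_subsets U v \<longleftrightarrow>
     (\<forall>S T. S \<subseteq> U \<longrightarrow> T \<subseteq> U \<longrightarrow> v (S \<union> T) \<le> v S + v T)"

text \<open>
  Vectors indexed by \<open>S\<close>, or by the subsets of \<open>S\<close>, are total functions of which only
  the values on \<open>S\<close>, respectively on \<open>Pow S\<close>, are constrained or used.
\<close>

definition primal_feasible :: "real \<Rightarrow> 'a set \<Rightarrow> ('a set \<Rightarrow> real) \<Rightarrow> bool" where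
  "primal_feasible \<kappa> S x \<longleftrightarrow>
     (\<forall>e\<in>S. (\<Sum>T | T \<subseteq> S \<and> e \<in> T. x T) \<le> \<kappa>) \<and>
     (\<Sum>T | T \<subseteq> S. x T) \<le> 1 \<and>
     (\<forall>T. T \<subseteq> S \<longrightarrow> 0 \<le> x T)"

text \<open>
  For finite \<open>S\<close> and \<open>\<kappa> \<ge> 0\<close> the feasible region is nonempty and compact, so this
  supremum is the maximum of the linear program.
\<close>

definition OPT_LP :: "('a set \<Rightarrow> real) \<Rightarrow> real \<Rightarrow> 'a set \<Rightarrow> real" where
  "OPT_LP v \<kappa> S = Sup {(\<Sum>T | T \<subseteq> S. v T * x T) | x. primal_feasible \<kappa> S x}"

definition dual_feasible :: "('a set \<Rightarrow> real) \<Rightarrow> 'a set \<Rightarrow> ('a \<Rightarrow> real) \<Rightarrow> real \<Rightarrow> bool" where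
  "dual_feasible v S p \<mu> \<longleftrightarrow>
     (\<forall>T. T \<subseteq> S \<longrightarrow> v T \<le> sum p T + \<mu>) \<and> (\<forall>e\<in>S. 0 \<le> p e) \<and> 0 \<le> \<mu>"

definition dual_optimal ::
  "('a set \<Rightarrow> real) \<Rightarrow> real \<Rightarrow> 'a set \<Rightarrow> ('a \<Rightarrow> real) \<Rightarrow> real \<Rightarrow> bool" where
  "dual_optimal v \<kappa> S p \<mu> \<longleftrightarrow>
     dual_feasible v S p \<mu> \<and>
     (\<forall>q \<nu>. dual_feasible v S q \<nu> \<longrightarrow> \<kappa> * sum p S + \<mu> \<le> \<kappa> * sum q S + \<nu>)"

text \<open>If \<open>sum p S = 0\<close> the quotient is \<open>0\<close> by convention, and the vector is zero.\<close>

definition scaled_price :: "real \<Rightarrow> 'a set \<Rightarrow> ('a \<Rightarrow> real) \<Rightarrow> 'a \<Rightarrow> real" where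
  "scaled_price B S p e = (if e \<in> S then p e * (B / sum p S) else 0)"

end

theory Submission
  imports Defs
begin

text \<open>
  Put \<open>T = {e \<in> S. d e < c e}\<close>. By subadditivity it suffices that \<open>v T\<close> is at most the
  value of the linear program. Dual feasibility gives \<open>v T \<le> p(T) + \<mu>\<close>, and scaling
  \<open>d(T) \<le> c(T) \<le> \<kappa> B\<close> by \<open>p(S) / B\<close> gives \<open>p(T) \<le> \<kappa> p(S)\<close>, so \<open>v T\<close> is at most the
  dual optimum, which equals the primal one by strong duality. Strong duality comes from
  Farkas' lemma, which is proved by Bartl's induction on the number of inequalities.
\<close>

section \<open>Farkas' lemma\<close>

text \<open>Induction with \<open>A\<close> and \<open>c\<close> generalized, because the hypothesis
  is used twice: for \<open>J\<close> as given and, if the vector \<open>z\<close> found there is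
  positive under the new functional, for all functionals projected along a multiple of
  \<open>z\<close>. Either alternative of the projected system lifts back.\<close>

lemma farkas:
  fixes A :: "'j \<Rightarrow> 'i \<Rightarrow> real" and c :: "'i \<Rightarrow> real"
  assumes "finite J" and "finite I"
  shows "(\<exists>l. (\<forall>j\<in>J. 0 \<le> l j) \<and> (\<forall>i\<in>I. c i = (\<Sum>j\<in>J. l j * A j i))) \<or>
    (\<exists>x. (\<forall>j\<in>J. (\<Sum>i\<in>I. A j i * x i) \<le> 0) \<and> 0 < (\<Sum>i\<in>I. c i * x i))"
  using assms(1)
proof (induction J arbitrary: A c rule: finite_induct)
  case empty
  show ?case
  proof (cases "\<exists>i\<in>I. c i \<noteq> 0")
    case True
    then obtain i where "i \<in> I" "0 < c i * c i"
      by (auto simp: zero_less_mult_iff linorder_neq_iff)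
    \<comment> \<open>Without inequalities the only combination is zero, so a nonzero
      \<open>c\<close> is separated by itself.\<close>
    then have "0 < (\<Sum>i\<in>I. c i * c i)"
      using sum_pos2[OF \<open>finite I\<close>, of i "\<lambda>i. c i * c i"] by simp
    then show ?thesis by auto
  qed auto
next
  case (insert k J)
  define dot where "dot a x = (\<Sum>i\<in>I. a i * x i)" for a x :: "'i \<Rightarrow> real"
  have dot_diff: "dot a (\<lambda>i. x i - r * w i) = dot a x - r * dot a w" for a x w r
    by (simp add: dot_def algebra_simps sum_subtractf sum_distrib_left)
  from insert.IH[of c A] consider
      (combination) l where "\<forall>j\<in>J. 0 \<le> l j" "\<forall>i\<in>I. c i = (\<Sum>j\<in>J. l j * A j i)"
    | (separated) z where "\<forall>j\<in>J. dot (A j) z \<le> 0" "0 < dot c z"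
    unfolding dot_def by blast
  then show ?case
  proof cases
    case combination
    let ?l = "l(k := 0)"
    have "(\<Sum>j\<in>insert k J. ?l j * A j i) = (\<Sum>j\<in>J. l j * A j i)" for i
      using insert.hyps by (auto intro!: sum.cong)
    then show ?thesis
      using combination by (intro disjI1 exI[of _ ?l]) auto
  next
    case separated
    show ?thesis
    proof (cases "dot (A k) z \<le> 0")
      case True
      then show ?thesis
        using separated unfolding dot_def by blast
    next
      case False
      \<comment> \<open>\<open>z\<close> scaled so that the new functional takes the value 1; the
        divisor is positive, so all signs are kept.\<close>
      define w where "w i = z i / dot (A k) z" for i
      have dot_w: "dot a w = dot a z / dot (A k) z" for a
        by (simp add: dot_def[of a] w_def sum_divide_distrib)
      have w: "dot (A k) w = 1" "0 < dot c w" "\<And>j. j \<in> J \<Longrightarrow> dot (A j) w \<le> 0"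
        using separated False by (auto simp: dot_w divide_nonpos_pos)
      \<comment> \<open>Project along \<open>w\<close> onto the kernel of the \<open>k\<close>-th functional.\<close>
      define P where "P a i = a i - dot a w * A k i" for a i
      have dot_P: "dot (P a) x = dot a (\<lambda>i. x i - dot (A k) x * w i)" for a x
      proof -
        have "dot (P a) x = dot a x - dot a w * dot (A k) x"
          by (simp add: P_def dot_def[of _ x] algebra_simps sum_subtractf sum_distrib_left)
        then show ?thesis
          by (simp add: dot_diff)
      qed
      from insert.IH[of "P c" "\<lambda>j. P (A j)"] consider
          (combination') l where "\<forall>j\<in>J. 0 \<le> l j" "\<forall>i\<in>I. P c i = (\<Sum>j\<in>J. l j * P (A j) i)"
        | (separated') x where "\<forall>j\<in>J. dot (P (A j)) x \<le> 0" "0 < dot (P c) x"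
        unfolding dot_def by blast
      then show ?thesis
      proof cases
        case combination'
        \<comment> \<open>The coefficient of \<open>A k\<close> left over when the projections are
          expanded. It is nonnegative since \<open>c\<close> is positive on \<open>w\<close> and
          each \<open>A j\<close> is at most 0 there.\<close>
        define r where "r = dot c w - (\<Sum>j\<in>J. l j * dot (A j) w)"
        have "(\<Sum>j\<in>J. l j * dot (A j) w) \<le> 0"
          using combination'(1) w(3) by (intro sum_nonpos mult_nonneg_nonpos) auto
        then have "0 \<le> r"
          using w(2) by (simp add: r_def)
        let ?l = "l(k := r)"
        have "c i = (\<Sum>j\<in>insert k J. ?l j * A j i)" if "i \<in> I" for i
        proof -
          have "(\<Sum>j\<in>insert k J. ?l j * A j i) = r * A k i + (\<Sum>j\<in>J. l j * A j i)"
            using insert.hyps by (auto intro!: sum.cong)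
          moreover have "c i - dot c w * A k i =
              (\<Sum>j\<in>J. l j * A j i) - (\<Sum>j\<in>J. l j * dot (A j) w) * A k i"
            using combination'(2) that unfolding P_def
            by (simp add: algebra_simps sum_subtractf sum_distrib_left)
          ultimately show ?thesis
            by (simp add: r_def algebra_simps)
        qed
        then show ?thesis
          using combination'(1) \<open>0 \<le> r\<close> by (intro disjI1 exI[of _ ?l]) auto
      next
        case separated'
        \<comment> \<open>By \<open>dot_P\<close> the original functionals take on \<open>y\<close>
          the values that the projected ones take on \<open>x\<close>, while \<open>A k\<close>
          vanishes on \<open>y\<close>.\<close>
        define y where "y = (\<lambda>i. x i - dot (A k) x * w i)"
        have "dot (A k) y = 0"
          using w(1) by (simp add: y_def dot_diff)
        then have "\<forall>j\<in>insert k J. dot (A j) y \<le> 0" "0 < dot c y"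
          using separated' by (auto simp: dot_P y_def)
        then show ?thesis
          unfolding dot_def by blast
      qed
    qed
  qed
qed

text \<open>The sign conditions on \<open>y\<close> enter Farkas' lemma as extra rows, the unit
  vectors indexed by \<open>Inr\<close>. Their nonnegative multipliers are the slack that turns the
  equality into an inequality.\<close>

lemma farkas_nonneg:
  fixes A :: "'j \<Rightarrow> 'i \<Rightarrow> real" and c :: "'i \<Rightarrow> real"
  assumes "finite J" and "finite I"
    and valid: "\<And>y. (\<And>i. i \<in> I \<Longrightarrow> 0 \<le> y i) \<Longrightarrow>
      (\<And>j. j \<in> J \<Longrightarrow> 0 \<le> (\<Sum>i\<in>I. A j i * y i)) \<Longrightarrow> 0 \<le> (\<Sum>i\<in>I. c i * y i)"
  obtains x where "\<And>j. j \<in> J \<Longrightarrow> 0 \<le> x j" and "\<And>i. i \<in> I \<Longrightarrow> (\<Sum>j\<in>J. x j * A j i) \<le> c i"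
proof -
  define A' where "A' s i = (case s of Inl j \<Rightarrow> A j i | Inr k \<Rightarrow> if i = k then 1 else 0)"
    for s :: "'j + 'i" and i
  have fin: "finite (J <+> I)"
    using assms by simp
  have False if sep: "\<forall>s\<in>J <+> I. (\<Sum>i\<in>I. A' s i * x i) \<le> 0" "0 < (\<Sum>i\<in>I. c i * x i)" for x
  proof -
    have "x k \<le> 0" if "k \<in> I" for k
    proof -
      have "(\<Sum>i\<in>I. A' (Inr k) i * x i) = x k"
        using that \<open>finite I\<close> by (simp add: A'_def if_distrib[of "\<lambda>a. a * _"] cong: if_cong)
      then show ?thesis
        using sep(1) that by (metis InrI)
    qed
    moreover have "(\<Sum>i\<in>I. A j i * x i) \<le> 0" if "j \<in> J" for j
      using sep(1) that by (auto simp: A'_def dest: bspec[OF _ InlI])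
    \<comment> \<open>All rows are nonpositive on \<open>x\<close>, so \<open>- x\<close> meets the
      premises of \<open>valid\<close>, yet \<open>c\<close> is negative on it.\<close>
    ultimately have "0 \<le> (\<Sum>i\<in>I. c i * - x i)"
      by (intro valid) (auto simp: sum_negf)
    then show False
      using sep(2) by (simp add: sum_negf)
  qed
  then obtain l where l: "\<forall>s\<in>J <+> I. 0 \<le> l s" "\<forall>i\<in>I. c i = (\<Sum>s\<in>J <+> I. l s * A' s i)"
    using farkas[OF fin \<open>finite I\<close>, of c A'] by blast
  show thesis
  proof
    show "0 \<le> l (Inl j)" if "j \<in> J" for j
      using l(1) that by blast
    show "(\<Sum>j\<in>J. l (Inl j) * A j i) \<le> c i" if "i \<in> I" for i
    proof -
      have "c i = (\<Sum>j\<in>J. l (Inl j) * A j i) + (\<Sum>k\<in>I. l (Inr k) * A' (Inr k) i)"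
        using l(2) that assms(1,2) by (simp add: sum.Plus A'_def)
      moreover have "0 \<le> (\<Sum>k\<in>I. l (Inr k) * A' (Inr k) i)"
        using l(1) by (intro sum_nonneg mult_nonneg_nonneg) (auto simp: A'_def)
      ultimately show ?thesis by simp
    qed
  qed
qed

section \<open>Strong duality for linear programs\<close>

text \<open>Optimality of \<open>y\<close>, with value \<open>D\<close>, yields an inequality valid
  on the cone of homogenized constraints; the Farkas multipliers certifying it form the solution
  \<open>x\<close> of the maximization.\<close>

lemma lp_strong_duality:
  fixes A :: "'i \<Rightarrow> 'j \<Rightarrow> real" and b :: "'i \<Rightarrow> real" and c :: "'j \<Rightarrow> real"
  assumes "finite I" and "finite J"
    and y0: "\<And>i. i \<in> I \<Longrightarrow> 0 \<le> y i" "\<And>j. j \<in> J \<Longrightarrow> c j \<le> (\<Sum>i\<in>I. A i j * y i)"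
    and opt: "\<And>z. (\<And>i. i \<in> I \<Longrightarrow> 0 \<le> z i) \<Longrightarrow>
      (\<And>j. j \<in> J \<Longrightarrow> c j \<le> (\<Sum>i\<in>I. A i j * z i)) \<Longrightarrow>
      (\<Sum>i\<in>I. b i * y i) \<le> (\<Sum>i\<in>I. b i * z i)"
  obtains x where "\<And>j. j \<in> J \<Longrightarrow> 0 \<le> x j" and "\<And>i. i \<in> I \<Longrightarrow> (\<Sum>j\<in>J. A i j * x j) \<le> b i"
    and "(\<Sum>i\<in>I. b i * y i) \<le> (\<Sum>j\<in>J. c j * x j)"
proof -
  define D where "D = (\<Sum>i\<in>I. b i * y i)"
  \<comment> \<open>The coordinate \<open>None\<close> homogenizes the dual constraints.\<close>
  define I' where "I' = insert None (Some ` I)"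
  define A' where "A' j s = (case s of None \<Rightarrow> - c j | Some i \<Rightarrow> A i j)" for j s
  \<comment> \<open>With the entry \<open>- D\<close> at \<open>None\<close>, the inequality
    obtained there says that the value of \<open>x\<close> is at least \<open>D\<close>.\<close>
  define b' where "b' s = (case s of None \<Rightarrow> - D | Some i \<Rightarrow> b i)" for s
  have sum_I': "(\<Sum>s\<in>I'. f s) = f None + (\<Sum>i\<in>I. f (Some i))" for f :: "'i option \<Rightarrow> real"
    using \<open>finite I\<close> by (simp add: I'_def sum.reindex)
  have "0 \<le> (\<Sum>s\<in>I'. b' s * z s)"
    if z: "\<And>s. s \<in> I' \<Longrightarrow> 0 \<le> z s" "\<And>j. j \<in> J \<Longrightarrow> 0 \<le> (\<Sum>s\<in>I'. A' j s * z s)" for z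
  proof -
    define t where "t = z None"
    have t: "0 \<le> t" and nonneg: "\<And>i. i \<in> I \<Longrightarrow> 0 \<le> z (Some i)"
      using z(1) by (auto simp: I'_def t_def)
    have row: "c j * t \<le> (\<Sum>i\<in>I. A i j * z (Some i))" if "j \<in> J" for j
      using z(2)[OF that] by (simp add: sum_I' A'_def t_def)
    have "D * t \<le> (\<Sum>i\<in>I. b i * z (Some i))"
    proof (cases "t = 0")
      case True
      \<comment> \<open>Here \<open>z\<close> is a recession direction: adding it to
        \<open>y\<close> keeps feasibility, so optimality of \<open>y\<close> rules out a negative
        cost.\<close>
      have "D \<le> (\<Sum>i\<in>I. b i * (y i + z (Some i)))"
        unfolding D_def
      proof (rule opt)
        show "c j \<le> (\<Sum>i\<in>I. A i j * (y i + z (Some i)))" if "j \<in> J" for j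
          using y0(2)[OF that] row[OF that] True by (simp add: distrib_left sum.distrib)
      qed (simp add: y0 nonneg)
      then show ?thesis
        using True by (simp add: distrib_left sum.distrib D_def)
    next
      case False
      with t have "0 < t" by simp
      \<comment> \<open>Dividing by \<open>t\<close> gives a feasible point of the original program,
        to be compared with \<open>y\<close>.\<close>
      have "D \<le> (\<Sum>i\<in>I. b i * (z (Some i) / t))"
        unfolding D_def
      proof (rule opt)
        show "c j \<le> (\<Sum>i\<in>I. A i j * (z (Some i) / t))" if "j \<in> J" for j
          using row[OF that] \<open>0 < t\<close> by (simp add: sum_divide_distrib[symmetric] pos_le_divide_eq)
      qed (simp add: t nonneg)
      then show ?thesis
        using \<open>0 < t\<close> by (simp add: sum_divide_distrib[symmetric] pos_le_divide_eq)
    qed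
    then show ?thesis
      by (simp add: sum_I' b'_def t_def)
  qed
  moreover have "finite I'"
    using \<open>finite I\<close> by (simp add: I'_def)
  ultimately obtain x where x: "\<And>j. j \<in> J \<Longrightarrow> 0 \<le> x j"
      "\<And>s. s \<in> I' \<Longrightarrow> (\<Sum>j\<in>J. x j * A' j s) \<le> b' s"
    using farkas_nonneg[OF \<open>finite J\<close>, of I' A' b'] by blast
  show thesis
  proof
    show "0 \<le> x j" if "j \<in> J" for j
      using x(1) that .
    show "(\<Sum>j\<in>J. A i j * x j) \<le> b i" if "i \<in> I" for i
      using x(2)[of "Some i"] that by (simp add: I'_def A'_def b'_def mult.commute)
    show "(\<Sum>i\<in>I. b i * y i) \<le> (\<Sum>j\<in>J. c j * x j)"
      using x(2)[of None] by (simp add: I'_def A'_def b'_def D_def sum_negf mult.commute)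
  qed
qed

section \<open>The linear program over subsets and its dual\<close>

text \<open>Strong duality with one column per subset of \<open>S\<close>. The inequality places the
  dual optimum below a feasible primal value, which is the direction that the final bound
  uses.\<close>

lemma dual_optimal_attained:
  assumes "finite S" and "dual_optimal v \<kappa> S p \<mu>"
  obtains x where "primal_feasible \<kappa> S x" and "\<kappa> * sum p S + \<mu> \<le> (\<Sum>T | T \<subseteq> S. v T * x T)"
proof -
  \<comment> \<open>The row \<open>None\<close> is the constraint on the total weight, with dual variable \<open>\<mu>\<close>.\<close>
  define I where "I = insert None (Some ` S)"
  define A :: "'a option \<Rightarrow> 'a set \<Rightarrow> real"
    where "A s T = (case s of None \<Rightarrow> 1 | Some e \<Rightarrow> if e \<in> T then 1 else 0)" for s T
  define b where "b s = (case s of None \<Rightarrow> 1 | Some e \<Rightarrow> \<kappa>)" for s :: "'a option"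
  define y where "y s = (case s of None \<Rightarrow> \<mu> | Some e \<Rightarrow> p e)" for s
  have fin: "finite I" "finite {T. T \<subseteq> S}"
    using \<open>finite S\<close> by (auto simp: I_def)
  have sum_I: "(\<Sum>s\<in>I. f s) = f None + (\<Sum>e\<in>S. f (Some e))" for f :: "'a option \<Rightarrow> real"
    using \<open>finite S\<close> by (simp add: I_def sum.reindex)
  have column: "(\<Sum>s\<in>I. A s T * z s) = z None + (\<Sum>e\<in>T. z (Some e))" if "T \<subseteq> S" for T z
  proof -
    have "(\<Sum>e\<in>S. A (Some e) T * z (Some e)) = (\<Sum>e\<in>S. if e \<in> T then z (Some e) else 0)"
      by (rule sum.cong) (auto simp: A_def)
    also have "\<dots> = (\<Sum>e\<in>T. z (Some e))"
      using \<open>finite S\<close> that by (simp add: sum.inter_restrict[symmetric] Int_absorb1)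
    finally show ?thesis
      by (simp add: sum_I A_def)
  qed
  have objective: "(\<Sum>s\<in>I. b s * z s) = z None + \<kappa> * (\<Sum>e\<in>S. z (Some e))" for z
    by (simp add: sum_I b_def sum_distrib_left)
  have dual: "dual_feasible v S p \<mu>"
    and min: "\<And>q \<nu>. dual_feasible v S q \<nu> \<Longrightarrow> \<kappa> * sum p S + \<mu> \<le> \<kappa> * sum q S + \<nu>"
    using assms(2) by (auto simp: dual_optimal_def)
  obtain x where x: "\<And>T. T \<in> {T. T \<subseteq> S} \<Longrightarrow> 0 \<le> x T"
      "\<And>s. s \<in> I \<Longrightarrow> (\<Sum>T | T \<subseteq> S. A s T * x T) \<le> b s"
      "(\<Sum>s\<in>I. b s * y s) \<le> (\<Sum>T | T \<subseteq> S. v T * x T)"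
  proof (rule lp_strong_duality[OF fin, of y v A b])
    show "0 \<le> y s" if "s \<in> I" for s
      using dual that by (auto simp: I_def y_def dual_feasible_def)
    show "v T \<le> (\<Sum>s\<in>I. A s T * y s)" if "T \<in> {T. T \<subseteq> S}" for T
      using dual that by (simp add: column y_def dual_feasible_def add.commute)
    show "(\<Sum>s\<in>I. b s * y s) \<le> (\<Sum>s\<in>I. b s * z s)"
      if z: "\<And>s. s \<in> I \<Longrightarrow> 0 \<le> z s" "\<And>T. T \<in> {T. T \<subseteq> S} \<Longrightarrow> v T \<le> (\<Sum>s\<in>I. A s T * z s)" for z
    proof -
      have "dual_feasible v S (\<lambda>e. z (Some e)) (z None)"
        using z by (auto simp: dual_feasible_def I_def[symmetric] column add.commute)
          (auto simp: I_def)
      from min[OF this] show ?thesis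
        by (simp add: objective y_def add.commute)
    qed
  qed blast
  have "(\<Sum>T | T \<subseteq> S \<and> e \<in> T. x T) \<le> \<kappa>" if "e \<in> S" for e
  proof -
    have "(\<Sum>T | T \<subseteq> S \<and> e \<in> T. x T) = (\<Sum>T | T \<subseteq> S. A (Some e) T * x T)"
      using fin(2) by (intro sum.mono_neutral_cong_left) (auto simp: A_def)
    then show ?thesis
      using x(2)[of "Some e"] that by (simp add: I_def b_def)
  qed
  moreover have "(\<Sum>T | T \<subseteq> S. x T) \<le> 1"
    using x(2)[of None] by (simp add: I_def A_def b_def)
  ultimately have "primal_feasible \<kappa> S x"
    using x(1) by (simp add: primal_feasible_def)
  then show thesis
    using x(3) that by (simp add: objective y_def add.commute)
qed

text \<open>The supremum dominates its members once the set of values is bounded above. Every weight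
  is at most the total 1, so with \<open>v\<close> nonnegative no value exceeds the sum of all
  \<open>v T\<close>.\<close>

lemma primal_value_le_OPT_LP:
  assumes "finite S" and "\<And>T. T \<subseteq> S \<Longrightarrow> 0 \<le> v T" and "primal_feasible \<kappa> S x"
  shows "(\<Sum>T | T \<subseteq> S. v T * x T) \<le> OPT_LP v \<kappa> S"
  unfolding OPT_LP_def
proof (rule cSup_upper)
  show "bdd_above {(\<Sum>T | T \<subseteq> S. v T * x T) | x. primal_feasible \<kappa> S x}"
  proof (rule bdd_aboveI, clarify)
    fix x assume x: "primal_feasible \<kappa> S x"
    have "x T \<le> 1" if "T \<subseteq> S" for T
    proof -
      have "x T \<le> (\<Sum>T | T \<subseteq> S. x T)"
        using x that \<open>finite S\<close> by (intro member_le_sum) (auto simp: primal_feasible_def)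
      then show ?thesis
        using x by (simp add: primal_feasible_def)
    qed
    then show "(\<Sum>T | T \<subseteq> S. v T * x T) \<le> (\<Sum>T | T \<subseteq> S. v T)"
      using assms(2) by (intro sum_mono) (auto intro: mult_left_le)
  qed
qed (use assms(3) in blast)

section \<open>The bound for the scaled prices\<close>

theorem lemma3p2:
  fixes U S :: "'a set" and v :: "'a set \<Rightarrow> real" and B \<kappa> \<mu> :: real
    and p d :: "'a \<Rightarrow> real"
  assumes "finite U"
    and "\<And>T. T \<subseteq> U \<Longrightarrow> 0 \<le> v T"
    and "monotone_on_subsets U v"
    and "subadditive_on_subsets U v"
    and "v {} = 0"
    and "0 \<le> B"
    and "0 < \<kappa>" and "\<kappa> < 1"
    and "S \<subseteq> U"
    and "dual_optimal v \<kappa> S p \<mu>"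
    and "\<And>e. e \<in> U \<Longrightarrow> d e = scaled_price B S p e"
  shows "(sum p S \<noteq> 0 \<longrightarrow> sum d S = B) \<and>
    (\<forall>c :: 'a \<Rightarrow> real. (\<forall>e\<in>S. 0 \<le> c e) \<longrightarrow> sum c S \<le> \<kappa> * B \<longrightarrow>
       v {e \<in> S. c e \<le> d e} \<ge> v S - OPT_LP v \<kappa> S)"
proof -
  have "finite S"
    using assms by (auto intro: finite_subset)
  have d: "d e = p e * (B / sum p S)" if "e \<in> S" for e
    using that assms(9,11) by (auto simp: scaled_price_def)
  have sum_d: "sum d T = sum p T * (B / sum p S)" if "T \<subseteq> S" for T
    unfolding sum_distrib_right using that d by (intro sum.cong) auto
  have p: "\<And>e. e \<in> S \<Longrightarrow> 0 \<le> p e" and "0 \<le> \<mu>"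
    and v_le: "\<And>T. T \<subseteq> S \<Longrightarrow> v T \<le> sum p T + \<mu>"
    using assms(10) by (auto simp: dual_optimal_def dual_feasible_def)
  have p_sum: "0 \<le> sum p T" if "T \<subseteq> S" for T
    using p that by (auto intro: sum_nonneg)
  obtain x where "primal_feasible \<kappa> S x" "\<kappa> * sum p S + \<mu> \<le> (\<Sum>T | T \<subseteq> S. v T * x T)"
    using dual_optimal_attained[OF \<open>finite S\<close> assms(10)] .
  then have OPT: "\<kappa> * sum p S + \<mu> \<le> OPT_LP v \<kappa> S"
    using primal_value_le_OPT_LP[of S v \<kappa> x] \<open>finite S\<close> assms(2,9) by fastforce
  have "v S - OPT_LP v \<kappa> S \<le> v {e \<in> S. c e \<le> d e}"
    if c: "\<forall>e\<in>S. 0 \<le> c e" "sum c S \<le> \<kappa> * B" for c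
  proof -
    define T where "T = {e \<in> S. d e < c e}"
    have T: "T \<subseteq> S" "finite T" "S = {e \<in> S. c e \<le> d e} \<union> T"
      using \<open>finite S\<close> by (auto simp: T_def)
    have "v S \<le> v {e \<in> S. c e \<le> d e} + v T"
    proof -
      have "{e \<in> S. c e \<le> d e} \<subseteq> U" "T \<subseteq> U"
        using assms(9) T(1) by auto
      then show ?thesis
        using assms(4) T(3) unfolding subadditive_on_subsets_def by metis
    qed
    moreover have "v T \<le> \<kappa> * sum p S + \<mu>"
    proof -
      \<comment> \<open>Cancelling the factor \<open>B / sum p S\<close> requires both quantities to
        be positive, so the degenerate cases are split off.\<close>
      consider "sum p S = 0" | "B = 0" | "0 < sum p S" "0 < B"
        using p_sum[of S] \<open>0 \<le> B\<close> by fastforce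
      then show ?thesis
      proof cases
        case 1
        \<comment> \<open>Nonnegative prices with sum zero leave \<open>\<mu>\<close> alone as a
          bound on \<open>v T\<close>.\<close>
        then have "sum p T = 0"
          using p_sum[OF T(1)] sum_mono2[OF \<open>finite S\<close> T(1), of p] p by auto
        then show ?thesis
          using v_le[OF T(1)] 1 by simp
      next
        case 2
        \<comment> \<open>A zero budget forces \<open>c\<close> to vanish on \<open>S\<close>, as
          \<open>d\<close> does, so \<open>T\<close> is empty.\<close>
        then have "\<forall>e\<in>S. c e = 0"
          using c \<open>finite S\<close> sum_nonneg_eq_0_iff[of S c] sum_nonneg[of S c] by auto
        then have "T = {}"
          using 2 by (auto simp: T_def d)
        then show ?thesis
          using assms(5,7) p_sum[of S] \<open>0 \<le> \<mu>\<close> by simp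
      next
        case 3
        have "sum d T \<le> sum c T"
          by (intro sum_mono) (auto simp: T_def)
        also have "\<dots> \<le> sum c S"
          using c(1) T(1) \<open>finite S\<close> by (intro sum_mono2) auto
        also have "\<dots> \<le> \<kappa> * B"
          by (rule c(2))
        finally have "sum p T \<le> \<kappa> * sum p S"
          using 3 by (simp add: sum_d[OF T(1)] field_simps)
        then show ?thesis
          using v_le[OF T(1)] by simp
      qed
    qed
    ultimately show ?thesis
      using OPT by simp
  qed
  \<comment> \<open>Part (i) is \<open>sum_d\<close> for \<open>S\<close> itself, where
    \<open>sum p S\<close> cancels; if it is zero, \<open>d\<close> vanishes on \<open>S\<close>,
    hence the guard.\<close>
  then show ?thesis
    using sum_d[of S] by simp
qed

end
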